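(* Let $\mathbb{C}$ be a centralic category and let $X,Y$ be objects of $\mathbb{C}$. For $f\in\mathsf{Z}(X,Y)$ and $g\in\mathbb{C}(X,Y)$ put $f\star g=\rho_{f,g}\circ(1_X,1_X)$, where $\rho_{f,g}\colon X\times X\to Y$ is the unique cooperator for $f$ and $g$. Then $\star$ restricts to a binary operation on $\mathsf{Z}(X,Y)$ which makes $\mathsf{Z}(X,Y)$ a commutative monoid with unit the zero morphism $0\colon X\to Y$, and the map $\star\colon\mathsf{Z}(X,Y)\times\mathbb{C}(X,Y)\to\mathbb{C}(X,Y)$ is an action of this commutative monoid on the set $\mathbb{C}(X,Y)$, i.e. $0\star h=h$ and $(f\star g)\star h=f\star(g\star h)$ for all $f,g\in\mathsf{Z}(X,Y)$ and $h\in\mathbb{C}(X,Y)$.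
   Context: A pointed category is a category with a zero object $0$; zero morphisms are also denoted $0$. For morphisms $x\colon S\to X$, $y\colon S\to Y$, $f\colon X\times Y\to Z$, write $f(x,y)$ for the composite $f\circ(x,y)\colon S\to Z$. A pointed category with finite products is called centralic if for every morphism $f\colon X\times Y\to Z$, every object $S$ and all morphisms $x,x'\colon S\to X$, $y\colon S\to Y$: $f(x,0)=f(x',0)$ implies $f(x,y)=f(x',y)$. Two morphisms $f\colon A\to X$ and $g\colon B\to X$ commute if there is a morphism $\rho\colon A\times B\to X$ (called a cooperator for $f$ and $g$) with $\rho\circ(1_A,0)=f$ and $\rho\circ(0,1_B)=g$. A morphism $f\colon A\to B$ is central if it commutes with $1_B$. $\mathbb{C}(X,Y)$ is the set of morphisms $X\to Y$ and $\mathsf{Z}(X,Y)\subseteq\mathbb{C}(X,Y)$ the subset of central morphisms. In a centralic category, a central morphism $f\colon X\to Y$ and an arbitrary morphism $g\colon X'\to Y$ always have exactly one cooperator $\rho_{f,g}\colon X\times X'\to Y$. *)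

theory Defs
  imports "HOL-Algebra.Group"
begin

section \<open>Categories\<close>

text \<open>
  A category is given by a set of objects and a set of morphisms over arbitrary types. Each
  morphism determines its domain and codomain; \<open>g \<cdot> f\<close> is ``first \<open>f\<close>, then \<open>g\<close>'' and is only
  meaningful if the codomain of \<open>f\<close> is the domain of \<open>g\<close>.
\<close>

record ('o, 'm) category =
  Obj :: "'o set"
  Mor :: "'m set"
  Dom :: "'m \<Rightarrow> 'o"
  Cod :: "'m \<Rightarrow> 'o"
  Ident :: "'o \<Rightarrow> 'm"
  Comp :: "'m \<Rightarrow> 'm \<Rightarrow> 'm"  (infixr "\<cdot>\<index>" 70)

definition Hom :: "('o, 'm, 'z) category_scheme \<Rightarrow> 'o \<Rightarrow> 'o \<Rightarrow> 'm set" where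
  "Hom C X Y = {f \<in> Mor C. Dom C f = X \<and> Cod C f = Y}"

locale category =
  fixes C :: "('o, 'm, 'z) category_scheme" (structure)
  assumes Dom_Obj: "f \<in> Mor C \<Longrightarrow> Dom C f \<in> Obj C"
    and Cod_Obj: "f \<in> Mor C \<Longrightarrow> Cod C f \<in> Obj C"
    and Ident_Hom: "X \<in> Obj C \<Longrightarrow> Ident C X \<in> Hom C X X"
    and Comp_Hom: "\<lbrakk>f \<in> Hom C X Y; g \<in> Hom C Y Z\<rbrakk> \<Longrightarrow> g \<cdot> f \<in> Hom C X Z"
    and Comp_Ident: "f \<in> Hom C X Y \<Longrightarrow> f \<cdot> Ident C X = f"
    and Ident_Comp: "f \<in> Hom C X Y \<Longrightarrow> Ident C Y \<cdot> f = f"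
    and Comp_assoc:
      "\<lbrakk>f \<in> Hom C W X; g \<in> Hom C X Y; h \<in> Hom C Y Z\<rbrakk> \<Longrightarrow> (h \<cdot> g) \<cdot> f = h \<cdot> (g \<cdot> f)"


section \<open>Pointed categories\<close>

definition terminal_object :: "('o, 'm, 'z) category_scheme \<Rightarrow> 'o \<Rightarrow> bool" where
  "terminal_object C T \<longleftrightarrow> T \<in> Obj C \<and> (\<forall>X\<in>Obj C. \<exists>!u. u \<in> Hom C X T)"

definition initial_object :: "('o, 'm, 'z) category_scheme \<Rightarrow> 'o \<Rightarrow> bool" where
  "initial_object C I \<longleftrightarrow> I \<in> Obj C \<and> (\<forall>X\<in>Obj C. \<exists>!u. u \<in> Hom C I X)"

definition zero_object :: "('o, 'm, 'z) category_scheme \<Rightarrow> 'o \<Rightarrow> bool" where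
  "zero_object C N \<longleftrightarrow> initial_object C N \<and> terminal_object C N"

text \<open>The composite \<open>X \<rightarrow> N \<rightarrow> Y\<close> does not depend on the zero object \<open>N\<close>.\<close>

definition zero_mor :: "('o, 'm, 'z) category_scheme \<Rightarrow> 'o \<Rightarrow> 'o \<Rightarrow> 'm" where
  "zero_mor C X Y =
     (THE h. \<exists>N u v. zero_object C N \<and> u \<in> Hom C X N \<and> v \<in> Hom C N Y \<and> h = v \<cdot>\<^bsub>C\<^esub> u)"

locale pointed_category = category +
  assumes ex_zero_object: "\<exists>N. zero_object C N"


section \<open>Finite products\<close>

definition is_product ::
  "('o, 'm, 'z) category_scheme \<Rightarrow> 'o \<Rightarrow> 'o \<Rightarrow> 'o \<Rightarrow> 'm \<Rightarrow> 'm \<Rightarrow> bool" where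
  "is_product C A B P p q \<longleftrightarrow>
     P \<in> Obj C \<and> p \<in> Hom C P A \<and> q \<in> Hom C P B \<and>
     (\<forall>S\<in>Obj C. \<forall>a\<in>Hom C S A. \<forall>b\<in>Hom C S B.
        \<exists>!h. h \<in> Hom C S P \<and> p \<cdot>\<^bsub>C\<^esub> h = a \<and> q \<cdot>\<^bsub>C\<^esub> h = b)"

text \<open>
  The symbol \<open>A \<times> B\<close> refers to a chosen product diagram. The choice is an arbitrary part of the
  data, so a statement about all such records is a statement about all categories with finite
  products and all choices of binary products in them.
\<close>

record ('o, 'm) product_category = "('o, 'm) category" +
  Prod :: "'o \<Rightarrow> 'o \<Rightarrow> 'o"
  Proj1 :: "'o \<Rightarrow> 'o \<Rightarrow> 'm"
  Proj2 :: "'o \<Rightarrow> 'o \<Rightarrow> 'm"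

locale finite_product_category = category C
  for C :: "('o, 'm, 'z) product_category_scheme" (structure) +
  assumes ex_terminal_object: "\<exists>T. terminal_object C T"
    and Prod_is_product:
      "\<lbrakk>A \<in> Obj C; B \<in> Obj C\<rbrakk> \<Longrightarrow> is_product C A B (Prod C A B) (Proj1 C A B) (Proj2 C A B)"

definition pair :: "('o, 'm, 'z) product_category_scheme \<Rightarrow> 'm \<Rightarrow> 'm \<Rightarrow> 'm" where
  "pair C x y =
     (THE h. h \<in> Hom C (Dom C x) (Prod C (Cod C x) (Cod C y)) \<and>
             Proj1 C (Cod C x) (Cod C y) \<cdot>\<^bsub>C\<^esub> h = x \<and>
             Proj2 C (Cod C x) (Cod C y) \<cdot>\<^bsub>C\<^esub> h = y)"


section \<open>Centralic categories\<close>

locale centralic_category = pointed_category C + finite_product_category C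
  for C :: "('o, 'm, 'z) product_category_scheme" (structure) +
  assumes centralic:
    "\<lbrakk>X \<in> Obj C; Y \<in> Obj C; Z \<in> Obj C; S \<in> Obj C; f \<in> Hom C (Prod C X Y) Z;
      x \<in> Hom C S X; x' \<in> Hom C S X; y \<in> Hom C S Y;
      f \<cdot> pair C x (zero_mor C S Y) = f \<cdot> pair C x' (zero_mor C S Y)\<rbrakk>
     \<Longrightarrow> f \<cdot> pair C x y = f \<cdot> pair C x' y"


section \<open>Commuting and central morphisms\<close>

definition is_cooperator ::
  "('o, 'm, 'z) product_category_scheme \<Rightarrow> 'm \<Rightarrow> 'm \<Rightarrow> 'm \<Rightarrow> bool" where
  "is_cooperator C f g \<rho> \<longleftrightarrow>
     \<rho> \<in> Hom C (Prod C (Dom C f) (Dom C g)) (Cod C f) \<and>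
     \<rho> \<cdot>\<^bsub>C\<^esub> pair C (Ident C (Dom C f)) (zero_mor C (Dom C f) (Dom C g)) = f \<and>
     \<rho> \<cdot>\<^bsub>C\<^esub> pair C (zero_mor C (Dom C g) (Dom C f)) (Ident C (Dom C g)) = g"

definition commutes :: "('o, 'm, 'z) product_category_scheme \<Rightarrow> 'm \<Rightarrow> 'm \<Rightarrow> bool" where
  "commutes C f g \<longleftrightarrow> (\<exists>\<rho>. is_cooperator C f g \<rho>)"

definition Central :: "('o, 'm, 'z) product_category_scheme \<Rightarrow> 'o \<Rightarrow> 'o \<Rightarrow> 'm set" where
  "Central C X Y = {f \<in> Hom C X Y. commutes C f (Ident C Y)}"

definition cooperator :: "('o, 'm, 'z) product_category_scheme \<Rightarrow> 'm \<Rightarrow> 'm \<Rightarrow> 'm" where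
  "cooperator C f g = (THE \<rho>. is_cooperator C f g \<rho>)"

definition star :: "('o, 'm, 'z) product_category_scheme \<Rightarrow> 'm \<Rightarrow> 'm \<Rightarrow> 'm" where
  "star C f g = cooperator C f g \<cdot>\<^bsub>C\<^esub> pair C (Ident C (Dom C f)) (Ident C (Dom C f))"


section \<open>Well-definedness\<close>

lemma HomD: "f \<in> Hom C X Y \<Longrightarrow> Dom C f = X \<and> Cod C f = Y"
  by (simp add: Hom_def)

context category
begin

lemma Hom_Obj: "f \<in> Hom C X Y \<Longrightarrow> X \<in> Obj C \<and> Y \<in> Obj C"
  unfolding Hom_def using Dom_Obj Cod_Obj by blast

lemma zero_factor_unique:
  assumes "zero_object C N" "u \<in> Hom C X N" "v \<in> Hom C N Y"
    and "zero_object C N'" "u' \<in> Hom C X N'" "v' \<in> Hom C N' Y"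
  shows "v \<cdot> u = v' \<cdot> u'"
proof -
  have ob: "X \<in> Obj C" "Y \<in> Obj C" "N \<in> Obj C" "N' \<in> Obj C"
    using assms Hom_Obj by blast+
  obtain t where t: "t \<in> Hom C N N'"
    using assms(1) ob unfolding zero_object_def initial_object_def by blast
  have "v' \<cdot> t = v"
    using Comp_Hom[OF t assms(6)] assms(1,3) ob
    unfolding zero_object_def initial_object_def by blast
  moreover have "t \<cdot> u = u'"
    using Comp_Hom[OF assms(2) t] assms(4,5) ob
    unfolding zero_object_def terminal_object_def by blast
  ultimately show ?thesis
    using Comp_assoc[OF assms(2) t assms(6)] by metis
qed

lemma zero_mor_eq:
  assumes "zero_object C N" "u \<in> Hom C X N" "v \<in> Hom C N Y"
  shows "zero_mor C X Y = v \<cdot> u"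
  unfolding zero_mor_def
  by (rule the_equality) (use assms zero_factor_unique in blast)+

end

context pointed_category
begin

lemma zero_mor_factor:
  assumes "X \<in> Obj C" "Y \<in> Obj C"
  obtains N u v where "zero_object C N" "u \<in> Hom C X N" "v \<in> Hom C N Y"
    "zero_mor C X Y = v \<cdot> u"
proof -
  obtain N where N: "zero_object C N"
    using ex_zero_object by blast
  obtain u v where "u \<in> Hom C X N" "v \<in> Hom C N Y"
    using N assms unfolding zero_object_def initial_object_def terminal_object_def by blast
  with N that zero_mor_eq show ?thesis
    by blast
qed

lemma zero_mor_Hom: "\<lbrakk>X \<in> Obj C; Y \<in> Obj C\<rbrakk> \<Longrightarrow> zero_mor C X Y \<in> Hom C X Y"
  by (rule zero_mor_factor[of X Y]) (simp_all add: Comp_Hom)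

lemma zero_mor_Comp:
  assumes f: "f \<in> Hom C W X" and Y: "Y \<in> Obj C"
  shows "zero_mor C X Y \<cdot> f = zero_mor C W Y"
proof -
  obtain N u v where *: "zero_object C N" "u \<in> Hom C X N" "v \<in> Hom C N Y"
      "zero_mor C X Y = v \<cdot> u"
    using zero_mor_factor Hom_Obj[OF f] Y by blast
  show ?thesis
    using zero_mor_eq[OF *(1) Comp_Hom[OF f *(2)] *(3)] Comp_assoc[OF f *(2,3)] *(4) by simp
qed

lemma Comp_zero_mor:
  assumes f: "f \<in> Hom C X Y" and W: "W \<in> Obj C"
  shows "f \<cdot> zero_mor C W X = zero_mor C W Y"
proof -
  obtain N u v where *: "zero_object C N" "u \<in> Hom C W N" "v \<in> Hom C N X"
      "zero_mor C W X = v \<cdot> u"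
    using zero_mor_factor Hom_Obj[OF f] W by blast
  show ?thesis
    using zero_mor_eq[OF *(1,2) Comp_Hom[OF *(3) f]] Comp_assoc[OF *(2,3) f] *(4) by simp
qed

end

context finite_product_category
begin

lemma Prod_Obj: "\<lbrakk>A \<in> Obj C; B \<in> Obj C\<rbrakk> \<Longrightarrow> Prod C A B \<in> Obj C"
  using Prod_is_product unfolding is_product_def by blast

lemma Proj_Hom:
  assumes "A \<in> Obj C" "B \<in> Obj C"
  shows "Proj1 C A B \<in> Hom C (Prod C A B) A" "Proj2 C A B \<in> Hom C (Prod C A B) B"
  using Prod_is_product[OF assms] unfolding is_product_def by blast+

lemma pair_ex1:
  assumes "x \<in> Hom C S A" "y \<in> Hom C S B"
  shows "\<exists>!h. h \<in> Hom C S (Prod C A B) \<and> Proj1 C A B \<cdot> h = x \<and> Proj2 C A B \<cdot> h = y"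
  using Prod_is_product[of A B] assms Hom_Obj unfolding is_product_def by blast

lemma pair_props:
  assumes "x \<in> Hom C S A" "y \<in> Hom C S B"
  shows "pair C x y \<in> Hom C S (Prod C A B)"
    and "Proj1 C A B \<cdot> pair C x y = x"
    and "Proj2 C A B \<cdot> pair C x y = y"
  using theI'[OF pair_ex1[OF assms]] HomD[OF assms(1)] HomD[OF assms(2)]
  unfolding pair_def by simp_all

lemma pair_unique:
  assumes h: "h \<in> Hom C S (Prod C A B)" "Proj1 C A B \<cdot> h = x" "Proj2 C A B \<cdot> h = y"
    and A: "A \<in> Obj C" "B \<in> Obj C"
  shows "pair C x y = h"
proof -
  have "x \<in> Hom C S A" "y \<in> Hom C S B"
    using h Proj_Hom[OF A] Comp_Hom by blast+
  from pair_ex1[OF this] pair_props[OF this] h show ?thesis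
    by blast
qed

lemma pair_Comp:
  assumes x: "x \<in> Hom C S A" and y: "y \<in> Hom C S B" and k: "k \<in> Hom C R S"
  shows "pair C x y \<cdot> k = pair C (x \<cdot> k) (y \<cdot> k)"
proof -
  have A: "A \<in> Obj C" "B \<in> Obj C"
    using Hom_Obj x y by blast+
  note p = pair_props[OF x y]
  show ?thesis
    using pair_unique[OF Comp_Hom[OF k p(1)] _ _ A, symmetric] p
      Comp_assoc[OF k p(1) Proj_Hom(1)[OF A]] Comp_assoc[OF k p(1) Proj_Hom(2)[OF A]]
    by simp
qed

lemma pair_Proj:
  assumes "A \<in> Obj C" "B \<in> Obj C"
  shows "pair C (Proj1 C A B) (Proj2 C A B) = Ident C (Prod C A B)"
  using pair_unique[OF Ident_Hom[OF Prod_Obj[OF assms]] _ _ assms] Comp_Ident Proj_Hom[OF assms]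
  by blast

end

context centralic_category
begin

lemma Comp_pair_zero:
  assumes \<phi>: "\<phi> \<in> Hom C (Prod C A B) W" and a: "a \<in> Hom C S A"
    and AB: "A \<in> Obj C" "B \<in> Obj C"
  shows "\<phi> \<cdot> pair C a (zero_mor C S B) = (\<phi> \<cdot> pair C (Ident C A) (zero_mor C A B)) \<cdot> a"
proof -
  note i = Ident_Hom[OF AB(1)] and z = zero_mor_Hom[OF AB]
  have "pair C (Ident C A) (zero_mor C A B) \<cdot> a = pair C a (zero_mor C S B)"
    using pair_Comp[OF i z a] Ident_Comp[OF a] zero_mor_Comp[OF a AB(2)] by simp
  then show ?thesis
    using Comp_assoc[OF a pair_props(1)[OF i z] \<phi>] by simp
qed

lemma Comp_zero_pair:
  assumes \<phi>: "\<phi> \<in> Hom C (Prod C A B) W" and b: "b \<in> Hom C S B"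
    and AB: "A \<in> Obj C" "B \<in> Obj C"
  shows "\<phi> \<cdot> pair C (zero_mor C S A) b = (\<phi> \<cdot> pair C (zero_mor C B A) (Ident C B)) \<cdot> b"
proof -
  note i = Ident_Hom[OF AB(2)] and z = zero_mor_Hom[OF AB(2,1)]
  have "pair C (zero_mor C B A) (Ident C B) \<cdot> b = pair C (zero_mor C S A) b"
    using pair_Comp[OF z i b] Ident_Comp[OF b] zero_mor_Comp[OF b AB(1)] by simp
  then show ?thesis
    using Comp_assoc[OF b pair_props(1)[OF z i] \<phi>] by simp
qed

lemma cooperator_ex1:
  assumes f: "f \<in> Central C X Y" and g: "g \<in> Hom C X' Y"
  shows "\<exists>!\<rho>. is_cooperator C f g \<rho>"
proof -
  have fH: "f \<in> Hom C X Y"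
    using f by (simp add: Central_def)
  have ob: "X \<in> Obj C" "Y \<in> Obj C" "X' \<in> Obj C"
    using fH g Hom_Obj by blast+
  note fD = HomD[OF fH] and gD = HomD[OF g] and iD = HomD[OF Ident_Hom[OF ob(2)]]
  obtain \<phi> where "is_cooperator C f (Ident C Y) \<phi>"
    using f by (auto simp: Central_def commutes_def)
  then have \<phi>: "\<phi> \<in> Hom C (Prod C X Y) Y"
      "\<phi> \<cdot> pair C (Ident C X) (zero_mor C X Y) = f"
      "\<phi> \<cdot> pair C (zero_mor C Y X) (Ident C Y) = Ident C Y"
    using fD iD by (simp_all add: is_cooperator_def)
  have \<phi>1: "\<phi> \<cdot> pair C a (zero_mor C S Y) = f \<cdot> a" if "a \<in> Hom C S X" for a S
    using Comp_pair_zero[OF \<phi>(1) that ob(1,2)] \<phi>(2) by simp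
  have \<phi>2: "\<phi> \<cdot> pair C (zero_mor C S X) b = b" if "b \<in> Hom C S Y" for b S
    using Comp_zero_pair[OF \<phi>(1) that ob(1,2)] \<phi>(3) Ident_Comp[OF that] by simp
  define P where "P = Prod C X X'"
  define p1 where "p1 = Proj1 C X X'"
  define p2 where "p2 = Proj2 C X X'"
  have P: "P \<in> Obj C" and p1: "p1 \<in> Hom C P X" and p2: "p2 \<in> Hom C P X'"
    using Prod_Obj Proj_Hom ob by (simp_all add: P_def p1_def p2_def)
  note gp2 = Comp_Hom[OF p2 g]
  define r where "r = \<phi> \<cdot> pair C p1 (g \<cdot> p2)"
  have r: "r \<in> Hom C P Y"
    unfolding r_def by (rule Comp_Hom[OF pair_props(1)[OF p1 gp2] \<phi>(1)])
  have r_pair: "r \<cdot> pair C a b = \<phi> \<cdot> pair C a (g \<cdot> b)"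
    if a: "a \<in> Hom C S X" and b: "b \<in> Hom C S X'" for a b S
  proof -
    note ab = pair_props[OF a b, folded P_def p1_def p2_def]
    have "pair C p1 (g \<cdot> p2) \<cdot> pair C a b = pair C a (g \<cdot> b)"
      using pair_Comp[OF p1 gp2 ab(1)] ab(2,3) Comp_assoc[OF ab(1) p2 g] by simp
    then show ?thesis
      using Comp_assoc[OF ab(1) pair_props(1)[OF p1 gp2] \<phi>(1)] by (simp add: r_def)
  qed
  have "r \<cdot> pair C (Ident C X) (zero_mor C X X') = f"
    using r_pair[OF Ident_Hom[OF ob(1)] zero_mor_Hom[OF ob(1,3)]]
      Comp_zero_mor[OF g ob(1)] \<phi>(2) by simp
  moreover have "r \<cdot> pair C (zero_mor C X' X) (Ident C X') = g"
    using r_pair[OF zero_mor_Hom[OF ob(3,1)] Ident_Hom[OF ob(3)]]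
      Comp_Ident[OF g] \<phi>2[OF g] by simp
  ultimately have ex: "is_cooperator C f g r"
    using r fD gD by (simp add: is_cooperator_def P_def)
  have "\<rho> = r" if "is_cooperator C f g \<rho>" for \<rho>
  proof -
    have \<rho>: "\<rho> \<in> Hom C P Y"
        "\<rho> \<cdot> pair C (Ident C X) (zero_mor C X X') = f"
        "\<rho> \<cdot> pair C (zero_mor C X' X) (Ident C X') = g"
      using that fD gD by (simp_all add: is_cooperator_def P_def)
    have \<rho>1: "\<rho> \<cdot> pair C a (zero_mor C S X') = f \<cdot> a" if "a \<in> Hom C S X" for a S
      using Comp_pair_zero[OF \<rho>(1)[unfolded P_def] that ob(1,3)] \<rho>(2) by simp
    have \<rho>2: "\<rho> \<cdot> pair C (zero_mor C S X) b = g \<cdot> b" if "b \<in> Hom C S X'" for b S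
      using Comp_zero_pair[OF \<rho>(1)[unfolded P_def] that ob(1,3)] \<rho>(3) by simp
    define Q where "Q = Prod C X X"
    define q1 where "q1 = Proj1 C X X"
    define q2 where "q2 = Proj2 C X X"
    have Q: "Q \<in> Obj C" and q1: "q1 \<in> Hom C Q X" and q2: "q2 \<in> Hom C Q X"
      using Prod_Obj Proj_Hom ob by (simp_all add: Q_def q1_def q2_def)
    define r1 where "r1 = Proj1 C Q X'"
    define r2 where "r2 = Proj2 C Q X'"
    have r1: "r1 \<in> Hom C (Prod C Q X') Q" and r2: "r2 \<in> Hom C (Prod C Q X') X'"
      using Proj_Hom Q ob by (simp_all add: r1_def r2_def)
    define k where "k = pair C (q2 \<cdot> r1) r2"
    note qr = Comp_Hom[OF r1 q1] Comp_Hom[OF r1 q2]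
    have k: "k \<in> Hom C (Prod C Q X') P"
      unfolding k_def P_def by (rule pair_props(1)[OF qr(2) r2])
    note \<rho>k = Comp_Hom[OF k \<rho>(1)]
    define G where "G = \<phi> \<cdot> pair C (q1 \<cdot> r1) (\<rho> \<cdot> k)"
    have G: "G \<in> Hom C (Prod C Q X') Y"
      unfolding G_def by (rule Comp_Hom[OF pair_props(1)[OF qr(1) \<rho>k] \<phi>(1)])
    have G_pair: "G \<cdot> pair C (pair C a b) c = \<phi> \<cdot> pair C a (\<rho> \<cdot> pair C b c)"
      if a: "a \<in> Hom C S X" and b: "b \<in> Hom C S X" and c: "c \<in> Hom C S X'" for a b c S
    proof -
      note ab = pair_props[OF a b, folded Q_def q1_def q2_def]
      define t where "t = pair C (pair C a b) c"
      note t = pair_props[OF ab(1) c, folded r1_def r2_def t_def]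
      have 1: "(q1 \<cdot> r1) \<cdot> t = a"
        using Comp_assoc[OF t(1) r1 q1] t(2) ab(2) by simp
      have 2: "(q2 \<cdot> r1) \<cdot> t = b"
        using Comp_assoc[OF t(1) r1 q2] t(2) ab(3) by simp
      have "k \<cdot> t = pair C b c"
        using pair_Comp[OF qr(2) r2 t(1)] 2 t(3) by (simp add: k_def)
      then have "(\<rho> \<cdot> k) \<cdot> t = \<rho> \<cdot> pair C b c"
        using Comp_assoc[OF t(1) k \<rho>(1)] by simp
      then have "pair C (q1 \<cdot> r1) (\<rho> \<cdot> k) \<cdot> t = pair C a (\<rho> \<cdot> pair C b c)"
        using pair_Comp[OF qr(1) \<rho>k t(1)] 1 by simp
      then show ?thesis
        using Comp_assoc[OF t(1) pair_props(1)[OF qr(1) \<rho>k] \<phi>(1)]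
        by (simp add: G_def t_def)
    qed
    note z = zero_mor_Hom[OF P ob(1)] and z' = zero_mor_Hom[OF P ob(3)]
    define x where "x = pair C p1 (zero_mor C P X)"
    define x' where "x' = pair C (zero_mor C P X) p1"
    have x: "x \<in> Hom C P Q" and x': "x' \<in> Hom C P Q"
      using pair_props(1)[OF p1 z] pair_props(1)[OF z p1] by (simp_all add: x_def x'_def Q_def)
    have "G \<cdot> pair C x (zero_mor C P X') = f \<cdot> p1"
      using G_pair[OF p1 z z'] \<rho>2[OF z'] Comp_zero_mor[OF g P] \<phi>1[OF p1] by (simp add: x_def)
    moreover have "G \<cdot> pair C x' (zero_mor C P X') = f \<cdot> p1"
      using G_pair[OF z p1 z'] \<rho>1[OF p1] \<phi>2[OF Comp_Hom[OF p1 fH]] by (simp add: x'_def)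
    ultimately have eq: "G \<cdot> pair C x p2 = G \<cdot> pair C x' p2"
      using centralic[OF Q ob(3,2) P G x x' p2] by simp
    have "G \<cdot> pair C x p2 = r"
      using G_pair[OF p1 z p2] \<rho>2[OF p2] by (simp add: x_def r_def)
    moreover have "pair C p1 p2 = Ident C P"
      using pair_Proj[OF ob(1,3)] by (simp add: p1_def p2_def P_def)
    then have "\<rho> \<cdot> pair C p1 p2 = \<rho>"
      using Comp_Ident[OF \<rho>(1)] by simp
    then have "G \<cdot> pair C x' p2 = \<rho>"
      using G_pair[OF z p1 p2] \<phi>2[OF \<rho>(1)] by (simp add: x'_def)
    ultimately show ?thesis
      using eq by simp
  qed
  with ex show ?thesis
    by blast
qed

lemma cooperator_is_cooperator:
  "\<lbrakk>f \<in> Central C X Y; g \<in> Hom C X' Y\<rbrakk> \<Longrightarrow> is_cooperator C f g (cooperator C f g)"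
  unfolding cooperator_def by (rule theI'[OF cooperator_ex1])

end

end

theory Submission
  imports Defs
begin

text \<open>
  A central \<open>f : X \<rightarrow> Y\<close> comes with a cooperator \<open>\<phi>\<^sub>f : X \<times> Y \<rightarrow> Y\<close> of \<open>f\<close> and \<open>1\<^sub>Y\<close>, to be thought of
  as \<open>\<phi>\<^sub>f(x, y) = f(x) + y\<close>. The composite \<open>\<phi>\<^sub>f(x, h(x'))\<close> is a cooperator of \<open>f\<close> and \<open>h\<close>, so
  uniqueness of cooperators gives \<open>f \<star> h = \<phi>\<^sub>f(1, h)\<close> (\<open>star_eq_translation\<close>). In this form, all
  the laws are comparisons of cooperators:

  \<^item> The second projection \<open>X \<times> Y \<rightarrow> Y\<close> is a cooperator of \<open>0\<close> and \<open>1\<^sub>Y\<close>, so \<open>0\<close> is central and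
    \<open>0 \<star> h = h\<close>.
  \<^item> The composite \<open>\<phi>\<^sub>f(x, \<phi>\<^sub>g(x, y))\<close> is a cooperator of \<open>f \<star> g\<close> and \<open>1\<^sub>Y\<close>
    (\<open>is_cooperator_star\<close>). Its existence says that \<open>f \<star> g\<close> is central; substituting \<open>y = h(x)\<close>
    gives \<open>(f \<star> g) \<star> h = f \<star> (g \<star> h)\<close>.
  \<^item> Exchanging the factors turns a cooperator of \<open>f\<close> and \<open>g\<close> into one of \<open>g\<close> and \<open>f\<close>
    (\<open>is_cooperator_swap\<close>), and the diagonal is invariant under the exchange, so
    \<open>f \<star> g = g \<star> f\<close> when both are central.
\<close>

context centralic_category
begin

lemma CentralD: "f \<in> Central C X Y \<Longrightarrow> f \<in> Hom C X Y"
  by (simp add: Central_def)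

lemma is_cooperator_iff:
  assumes "f \<in> Hom C A Y" "g \<in> Hom C B Y"
  shows "is_cooperator C f g \<rho> \<longleftrightarrow>
    \<rho> \<in> Hom C (Prod C A B) Y \<and>
    \<rho> \<cdot> pair C (Ident C A) (zero_mor C A B) = f \<and>
    \<rho> \<cdot> pair C (zero_mor C B A) (Ident C B) = g"
  using HomD[OF assms(1)] HomD[OF assms(2)] by (simp add: is_cooperator_def)

lemma Comp_pair_Comp:
  assumes \<rho>: "\<rho> \<in> Hom C (Prod C A B) Z"
    and u: "u \<in> Hom C P A" and v: "v \<in> Hom C P B" and t: "t \<in> Hom C S P"
  shows "(\<rho> \<cdot> pair C u v) \<cdot> t = \<rho> \<cdot> pair C (u \<cdot> t) (v \<cdot> t)"
  using Comp_assoc[OF t pair_props(1)[OF u v] \<rho>] pair_Comp[OF u v t] by simp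

lemma is_cooperator_swap:
  assumes \<rho>: "is_cooperator C f g \<rho>"
    and f: "f \<in> Hom C A Y" and g: "g \<in> Hom C B Y"
  shows "is_cooperator C g f (\<rho> \<cdot> pair C (Proj2 C B A) (Proj1 C B A))"
proof -
  have ob: "A \<in> Obj C" "B \<in> Obj C"
    using f g Hom_Obj by blast+
  have r: "\<rho> \<in> Hom C (Prod C A B) Y"
      "\<rho> \<cdot> pair C (Ident C A) (zero_mor C A B) = f"
      "\<rho> \<cdot> pair C (zero_mor C B A) (Ident C B) = g"
    using \<rho> by (simp_all add: is_cooperator_iff[OF f g])
  note p = Proj_Hom[OF ob(2,1)]
  note i = pair_props[OF Ident_Hom[OF ob(2)] zero_mor_Hom[OF ob(2,1)]]
  note j = pair_props[OF zero_mor_Hom[OF ob] Ident_Hom[OF ob(1)]]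
  show ?thesis
    unfolding is_cooperator_iff[OF g f]
    using Comp_Hom[OF pair_props(1)[OF p(2,1)] r(1)]
      Comp_pair_Comp[OF r(1) p(2,1) i(1)] Comp_pair_Comp[OF r(1) p(2,1) j(1)]
      i(2,3) j(2,3) r(2,3) by simp
qed

lemma star_eq:
  assumes f: "f \<in> Central C X Y" and g: "g \<in> Hom C X Y" and \<rho>: "is_cooperator C f g \<rho>"
  shows "star C f g = \<rho> \<cdot> pair C (Ident C X) (Ident C X)"
proof -
  have "cooperator C f g = \<rho>"
    using cooperator_ex1[OF f g] cooperator_is_cooperator[OF f g] \<rho> by blast
  then show ?thesis
    using HomD[OF CentralD[OF f]] by (simp add: star_def)
qed

text \<open>
  This replaces the cooperator of \<open>f\<close> and \<open>h\<close>, which varies with \<open>h\<close>, by a single morphism \<open>\<phi>\<close>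
  depending on \<open>f\<close> only.
\<close>

lemma star_eq_translation:
  assumes fH: "f \<in> Hom C X Y" and \<phi>: "is_cooperator C f (Ident C Y) \<phi>" and h: "h \<in> Hom C X Y"
  shows "star C f h = \<phi> \<cdot> pair C (Ident C X) h"
proof -
  have ob: "X \<in> Obj C" "Y \<in> Obj C"
    using h Hom_Obj by blast+
  note iX = Ident_Hom[OF ob(1)] and iY = Ident_Hom[OF ob(2)] and z = zero_mor_Hom[OF ob(1,1)]
  have f: "f \<in> Central C X Y"
    using fH \<phi> by (auto simp: Central_def commutes_def)
  have r: "\<phi> \<in> Hom C (Prod C X Y) Y"
      "\<phi> \<cdot> pair C (Ident C X) (zero_mor C X Y) = f"
      "\<phi> \<cdot> pair C (zero_mor C Y X) (Ident C Y) = Ident C Y"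
    using \<phi> by (simp_all add: is_cooperator_iff[OF fH iY])
  define p where "p = Proj1 C X X"
  define q where "q = Proj2 C X X"
  have p: "p \<in> Hom C (Prod C X X) X" and q: "q \<in> Hom C (Prod C X X) X"
    using Proj_Hom[OF ob(1,1)] by (simp_all add: p_def q_def)
  note hq = Comp_Hom[OF q h]
  define \<rho> where "\<rho> = \<phi> \<cdot> pair C p (h \<cdot> q)"
  have \<rho>: "\<rho> \<in> Hom C (Prod C X X) Y"
    unfolding \<rho>_def by (rule Comp_Hom[OF pair_props(1)[OF p hq] r(1)])
  have \<rho>_pair: "\<rho> \<cdot> pair C a b = \<phi> \<cdot> pair C a (h \<cdot> b)"
    if a: "a \<in> Hom C X X" and b: "b \<in> Hom C X X" for a b
  proof -
    note ab = pair_props[OF a b, folded p_def q_def]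
    show ?thesis
      using Comp_pair_Comp[OF r(1) p hq ab(1)] Comp_assoc[OF ab(1) q h] ab(2,3)
      by (simp add: \<rho>_def)
  qed
  have "\<rho> \<cdot> pair C (Ident C X) (zero_mor C X X) = f"
    using \<rho>_pair[OF iX z] Comp_zero_mor[OF h ob(1)] r(2) by simp
  moreover have "\<rho> \<cdot> pair C (zero_mor C X X) (Ident C X) = h"
    using \<rho>_pair[OF z iX] Comp_Ident[OF h] Comp_zero_pair[OF r(1) h ob] r(3) Ident_Comp[OF h]
    by simp
  ultimately have "is_cooperator C f h \<rho>"
    using \<rho> by (simp add: is_cooperator_iff[OF fH h])
  then show ?thesis
    using star_eq[OF f h] \<rho>_pair[OF iX iX] Comp_Ident[OF h] by simp
qed

lemma star_Hom:
  assumes f: "f \<in> Central C X Y" and h: "h \<in> Hom C X Y"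
  shows "star C f h \<in> Hom C X Y"
proof -
  have i: "Ident C X \<in> Hom C X X"
    using Ident_Hom Hom_Obj[OF h] by blast
  have "cooperator C f h \<in> Hom C (Prod C X X) Y"
    using cooperator_is_cooperator[OF f h] is_cooperator_iff[OF CentralD[OF f] h] by blast
  then show ?thesis
    using Comp_Hom[OF pair_props(1)[OF i i]] star_eq[OF f h cooperator_is_cooperator[OF f h]]
    by simp
qed

lemma is_cooperator_zero:
  assumes "X \<in> Obj C" "Y \<in> Obj C"
  shows "is_cooperator C (zero_mor C X Y) (Ident C Y) (Proj2 C X Y)"
  unfolding is_cooperator_iff[OF zero_mor_Hom[OF assms] Ident_Hom[OF assms(2)]]
  using Proj_Hom(2)[OF assms] pair_props(3)[OF Ident_Hom[OF assms(1)] zero_mor_Hom[OF assms]]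
    pair_props(3)[OF zero_mor_Hom[OF assms(2,1)] Ident_Hom[OF assms(2)]]
  by simp

lemma zero_mor_Central: "\<lbrakk>X \<in> Obj C; Y \<in> Obj C\<rbrakk> \<Longrightarrow> zero_mor C X Y \<in> Central C X Y"
  using is_cooperator_zero zero_mor_Hom by (auto simp: Central_def commutes_def)

lemma zero_star:
  assumes h: "h \<in> Hom C X Y"
  shows "star C (zero_mor C X Y) h = h"
proof -
  have ob: "X \<in> Obj C" "Y \<in> Obj C"
    using h Hom_Obj by blast+
  show ?thesis
    using star_eq_translation[OF zero_mor_Hom[OF ob] is_cooperator_zero[OF ob] h]
      pair_props(3)[OF Ident_Hom[OF ob(1)] h] by simp
qed

text \<open>
  In the notation \<open>\<phi>(x, y) = f(x) + y\<close> and \<open>\<gamma>(x, y) = g(x) + y\<close>, this cooperator is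
  \<open>f(x) + (g(x) + y)\<close>. It serves both for closure under \<open>\<star>\<close> and for associativity.
\<close>

lemma is_cooperator_star:
  assumes f: "f \<in> Hom C X Y" and \<phi>: "is_cooperator C f (Ident C Y) \<phi>"
    and g: "g \<in> Hom C X Y" and \<gamma>: "is_cooperator C g (Ident C Y) \<gamma>"
  shows "is_cooperator C (star C f g) (Ident C Y) (\<phi> \<cdot> pair C (Proj1 C X Y) \<gamma>)"
proof -
  have ob: "X \<in> Obj C" "Y \<in> Obj C"
    using f Hom_Obj by blast+
  note iX = Ident_Hom[OF ob(1)] and iY = Ident_Hom[OF ob(2)]
  have r: "\<phi> \<in> Hom C (Prod C X Y) Y"
      "\<phi> \<cdot> pair C (zero_mor C Y X) (Ident C Y) = Ident C Y"
    using \<phi> by (simp_all add: is_cooperator_iff[OF f iY])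
  have s: "\<gamma> \<in> Hom C (Prod C X Y) Y"
      "\<gamma> \<cdot> pair C (Ident C X) (zero_mor C X Y) = g"
      "\<gamma> \<cdot> pair C (zero_mor C Y X) (Ident C Y) = Ident C Y"
    using \<gamma> by (simp_all add: is_cooperator_iff[OF g iY])
  note p = Proj_Hom(1)[OF ob]
  note i = pair_props[OF iX zero_mor_Hom[OF ob]]
  note j = pair_props[OF zero_mor_Hom[OF ob(2,1)] iY]
  have fg: "star C f g \<in> Hom C X Y"
    using star_Hom[OF _ g] f \<phi> by (auto simp: Central_def commutes_def)
  show ?thesis
    unfolding is_cooperator_iff[OF fg iY]
    using Comp_Hom[OF pair_props(1)[OF p s(1)] r(1)]
      Comp_pair_Comp[OF r(1) p s(1) i(1)] Comp_pair_Comp[OF r(1) p s(1) j(1)]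
      i(2) j(2) r(2) s(2,3) star_eq_translation[OF f \<phi> g] by simp
qed

lemma star_Central:
  assumes f: "f \<in> Central C X Y" and g: "g \<in> Central C X Y"
  shows "star C f g \<in> Central C X Y"
proof -
  obtain \<phi> \<gamma> where "is_cooperator C f (Ident C Y) \<phi>" "is_cooperator C g (Ident C Y) \<gamma>"
    using f g by (auto simp: Central_def commutes_def)
  from is_cooperator_star[OF CentralD[OF f] this(1) CentralD[OF g] this(2)]
  show ?thesis
    using star_Hom[OF f CentralD[OF g]] by (auto simp: Central_def commutes_def)
qed

lemma star_assoc:
  assumes f: "f \<in> Central C X Y" and g: "g \<in> Central C X Y" and h: "h \<in> Hom C X Y"
  shows "star C (star C f g) h = star C f (star C g h)"
proof -
  have ob: "X \<in> Obj C" "Y \<in> Obj C"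
    using h Hom_Obj by blast+
  note iX = Ident_Hom[OF ob(1)] and iY = Ident_Hom[OF ob(2)]
  note fH = CentralD[OF f] and gH = CentralD[OF g]
  obtain \<phi> \<gamma> where \<phi>: "is_cooperator C f (Ident C Y) \<phi>" and \<gamma>: "is_cooperator C g (Ident C Y) \<gamma>"
    using f g by (auto simp: Central_def commutes_def)
  have r: "\<phi> \<in> Hom C (Prod C X Y) Y" and s: "\<gamma> \<in> Hom C (Prod C X Y) Y"
    using \<phi> \<gamma> by (simp_all add: is_cooperator_iff[OF fH iY] is_cooperator_iff[OF gH iY])
  note t = pair_props[OF iX h]
  have "star C (star C f g) h = (\<phi> \<cdot> pair C (Proj1 C X Y) \<gamma>) \<cdot> pair C (Ident C X) h"
    by (rule star_eq_translation[OF star_Hom[OF f gH] is_cooperator_star[OF fH \<phi> gH \<gamma>] h])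
  also have "\<dots> = \<phi> \<cdot> pair C (Ident C X) (star C g h)"
    using Comp_pair_Comp[OF r Proj_Hom(1)[OF ob] s t(1)] t(2) star_eq_translation[OF gH \<gamma> h]
    by simp
  also have "\<dots> = star C f (star C g h)"
    by (rule star_eq_translation[OF fH \<phi> star_Hom[OF g h], symmetric])
  finally show ?thesis .
qed

lemma star_commute:
  assumes f: "f \<in> Central C X Y" and g: "g \<in> Central C X Y"
  shows "star C f g = star C g f"
proof -
  note fH = CentralD[OF f] and gH = CentralD[OF g]
  have X: "X \<in> Obj C"
    using fH Hom_Obj by blast
  note i = Ident_Hom[OF X] and p = Proj_Hom[OF X X]
  note d = pair_props[OF i i]
  let ?\<rho> = "cooperator C f g"
  note \<rho> = cooperator_is_cooperator[OF f gH]
  have r: "?\<rho> \<in> Hom C (Prod C X X) Y"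
    using \<rho> is_cooperator_iff[OF fH gH] by blast
  show ?thesis
    using star_eq[OF f gH \<rho>] star_eq[OF g fH is_cooperator_swap[OF \<rho> fH gH]]
      Comp_pair_Comp[OF r p(2,1) d(1)] d(2,3) by simp
qed

end

theorem mainTheorem6:
  fixes C :: "('o, 'm, 'z) product_category_scheme" and X Y :: 'o
  assumes "centralic_category C" and "X \<in> Obj C" and "Y \<in> Obj C"
  shows "comm_monoid \<lparr>carrier = Central C X Y, mult = star C, one = zero_mor C X Y\<rparr> \<and>
    (\<forall>f\<in>Central C X Y. \<forall>h\<in>Hom C X Y. star C f h \<in> Hom C X Y) \<and>
    (\<forall>h\<in>Hom C X Y. star C (zero_mor C X Y) h = h) \<and>
    (\<forall>f\<in>Central C X Y. \<forall>g\<in>Central C X Y. \<forall>h\<in>Hom C X Y.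
       star C (star C f g) h = star C f (star C g h))"
proof -
  interpret centralic_category C
    by (rule assms(1))
  have "comm_monoid \<lparr>carrier = Central C X Y, mult = star C, one = zero_mor C X Y\<rparr>"
  proof (rule comm_monoidI, simp_all)
    show "star C f g \<in> Central C X Y" if "f \<in> Central C X Y" "g \<in> Central C X Y" for f g
      using that by (rule star_Central)
    show "zero_mor C X Y \<in> Central C X Y"
      using assms(2,3) by (rule zero_mor_Central)
    show "star C (star C f g) h = star C f (star C g h)"
      if "f \<in> Central C X Y" "g \<in> Central C X Y" "h \<in> Central C X Y" for f g h
      using that by (intro star_assoc CentralD)
    show "star C (zero_mor C X Y) f = f" if "f \<in> Central C X Y" for f
      using that by (intro zero_star CentralD)
    show "star C f g = star C g f" if "f \<in> Central C X Y" "g \<in> Central C X Y" for f g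
      using that by (rule star_commute)
  qed
  then show ?thesis
    using star_Hom zero_star star_assoc by blast
qed

end
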